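(* Let $\alpha\in(0,1)$ and $\gamma>0$ be fixed constants. There exists a constant $c=c(\alpha,\gamma)>0$ such that, with probability $1-o(1)$ as $n\to\infty$ over the random graph $G\sim\mathcal{G}(n,\frac12,k=\lfloor n^\alpha\rfloor)$ with planted clique $\mathcal{PC}$, the following holds. For every function $h:[n]\to\mathbb{R}$ and every $\beta\in\mathbb{R}$ there is an initial clique $x_0\in\Omega(G)$ such that the Metropolis process $\{X_t\}$ on $G$ with stationary distribution $\pi_\beta$ started from $X_0=x_0$ requires, with probability at least $1-n^{-c\log n}$, at least $n^{c\log n}$ steps to reach a clique of intersection at least $\gamma\log n$ with the planted clique; that is, $$\Pr\big(\exists\, t\in\mathbb{N},\ t<n^{c\log n}:\ |X_t\cap\mathcal{PC}|\ge\gamma\log n \,\big|\, X_0=x_0\big)\le n^{-c\log n}.$$ In particular, under the worst-case initialization the Metropolis process fails to recover the planted clique in polynomial time.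
   Context: Conventions: $\log$ is the base-2 logarithm; $[n]=\{0,1,\dots,n\}$. Planted clique model: $\mathcal{G}(n,\frac12,k)$ is the random graph on an $n$-element vertex set $V$ obtained by sampling $\mathcal{G}(n,\frac12)$ (each pair is an edge independently with probability $1/2$), choosing a uniformly random $k$-subset $\mathcal{PC}\subseteq V$ (the planted clique), and adding all edges between vertices of $\mathcal{PC}$. $\Omega(G)$ denotes the set of all cliques of $G$, i.e. vertex subsets (including $\emptyset$) whose vertices are pairwise adjacent. Gibbs measure: for $h:[n]\to\mathbb{R}$, written $h_q=h(q)$, and $\beta\in\mathbb{R}$, $\pi_\beta(C)\propto\exp(\beta h_{|C|})$ for $C\in\Omega(G)$. Metropolis process: the Markov chain $\{X_t\}$ on $\Omega(G)$ which at step $t$ picks $v\in V$ uniformly at random and sets $C=X_{t-1}\oplus\{v\}$ (symmetric difference). If $C\in\Omega(G)$, then $X_t=C$ with probability $\min\{1,\pi_\beta(C)/\pi_\beta(X_{t-1})\}=\min\{1,\exp(\beta(h_{|C|}-h_{|X_{t-1}|}))\}$ and $X_t=X_{t-1}$ otherwise. If $C\notin\Omega(G)$, then $X_t=X_{t-1}$. Recovering the planted clique means reaching the state $X_t=\mathcal{PC}$. *)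

theory Defs
  imports "HOL-Probability.Probability" "HOL-Library.Ramsey" "HOL-Library.Monad_Syntax"
begin

text \<open>
  Graphs on the vertex set \<open>{..<n}\<close> are represented by their edge sets, i.e. sets of
  two-element subsets of \<open>{..<n}\<close>. The predicate \<open>clique\<close> is the one from the Ramsey theory.
\<close>

definition random_graph :: "nat \<Rightarrow> nat set set pmf" where
  "random_graph n =
     map_pmf (\<lambda>f. {e \<in> nsets {..<n} 2. f e})
       (Pi_pmf (nsets {..<n} 2) False (\<lambda>_. bernoulli_pmf (1/2)))"

text \<open>Joint law of the edge set and the planted clique; meaningful for \<open>k \<le> n\<close>.\<close>

definition planted_clique_model :: "nat \<Rightarrow> nat \<Rightarrow> (nat set set \<times> nat set) pmf" where
  "planted_clique_model n k =
     do {
       E \<leftarrow> random_graph n;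
       PC \<leftarrow> pmf_of_set (nsets {..<n} k);
       return_pmf (E \<union> nsets PC 2, PC)
     }"

definition cliques :: "nat \<Rightarrow> nat set set \<Rightarrow> nat set set" where
  "cliques n E = {C. C \<subseteq> {..<n} \<and> clique C E}"

text \<open>
  The probability mass assigned to a clique \<open>C\<close>. Since cliques have at most \<open>n\<close> vertices, only
  the values of \<open>h\<close> on \<open>{0..n}\<close> matter.
\<close>

definition gibbs :: "nat \<Rightarrow> nat set set \<Rightarrow> (nat \<Rightarrow> real) \<Rightarrow> real \<Rightarrow> nat set \<Rightarrow> real" where
  "gibbs n E h \<beta> C =
     exp (\<beta> * h (card C)) / (\<Sum>D\<in>cliques n E. exp (\<beta> * h (card D)))"

definition metropolis_step ::
  "nat \<Rightarrow> nat set set \<Rightarrow> (nat \<Rightarrow> real) \<Rightarrow> real \<Rightarrow> nat set \<Rightarrow> nat set pmf" where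
  "metropolis_step n E h \<beta> X =
     do {
       v \<leftarrow> pmf_of_set {..<n};
       let C = sym_diff X {v};
       if C \<in> cliques n E
       then do {
         accept \<leftarrow> bernoulli_pmf (min 1 (gibbs n E h \<beta> C / gibbs n E h \<beta> X));
         return_pmf (if accept then C else X)
       }
       else return_pmf X
     }"

text \<open>
  Law of the trajectory \<open>[X\<^sub>0, \<dots>, X\<^sub>T]\<close> started from \<open>X\<^sub>0 = x\<close>. Events that only depend on a bounded
  number of steps of the chain are events of a trajectory that is long enough.
\<close>

fun metropolis_path ::
  "nat \<Rightarrow> nat set set \<Rightarrow> (nat \<Rightarrow> real) \<Rightarrow> real \<Rightarrow> nat \<Rightarrow> nat set \<Rightarrow> nat set list pmf" where
  "metropolis_path n E h \<beta> 0 x = return_pmf [x]"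
| "metropolis_path n E h \<beta> (Suc T) x =
     do {
       y \<leftarrow> metropolis_step n E h \<beta> x;
       Xs \<leftarrow> metropolis_path n E h \<beta> T y;
       return_pmf (x # Xs)
     }"

lemma finite_cliques: "finite (cliques n E)"
  by (rule finite_subset[of _ "Pow {..<n}"]) (auto simp: cliques_def)

lemma empty_in_cliques: "{} \<in> cliques n E"
  by (simp add: cliques_def)

lemma gibbs_ratio:
  "gibbs n E h \<beta> C / gibbs n E h \<beta> X = exp (\<beta> * (h (card C) - h (card X)))"
proof -
  have "(\<Sum>D\<in>cliques n E. exp (\<beta> * h (card D))) > 0"
    by (rule sum_pos2[OF finite_cliques empty_in_cliques]) auto
  then show ?thesis
    by (simp add: gibbs_def exp_diff right_diff_distrib)
qed

lemma length_metropolis_path: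
  "Xs \<in> set_pmf (metropolis_path n E h \<beta> T x) \<Longrightarrow> length Xs = Suc T"
  by (induction T arbitrary: x Xs) auto

end

theory Submission
  imports Defs "HOL-Real_Asymp.Real_Asymp"
begin

text \<open>
  Let \<open>L = log 2 n\<close>, \<open>y = min \<gamma> (1 - \<alpha>)\<close> and \<open>r = \<lfloor>y * L\<rfloor>\<close>. A step changes the intersection with the planted clique
  by at most one vertex, so a chain started below intersection \<open>r\<close> has to pass through the cliques of
  intersection exactly \<open>r\<close>. Comparing layer by layer, i.e. among cliques of the same size \<open>q\<close>, makes the
  Gibbs weights cancel, and it suffices that for every \<open>q\<close> the cliques of intersection \<open>r\<close> are a
  fraction \<open>2 powr (- \<Omega>(L\<^sup>2))\<close> of those of intersection \<open>0\<close>. This is one graph event, independent of \<open>h\<close>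
  and \<open>\<beta>\<close>; by reversibility the stationary measure restricted to intersection \<open>< r\<close> then is, on average, a
  slow starting point.

  The ratio of the expected counts is about \<open>(n powr (\<alpha> - 1)) ^ r * 2 ^ (r choose 2)\<close>, which is
  quasi-polynomially small because \<open>r \<le> (1 - \<alpha>) * L\<close>. For \<open>q \<le> Q = \<lfloor>(2 - c) * L\<rfloor>\<close> the number of unplanted
  cliques is concentrated by the second moment method. For \<open>q = Q\<close> the expected number of cliques of
  intersection \<open>r\<close> already tends to \<open>0\<close>, so for \<open>q \<ge> Q\<close> there are none.
\<close>

subsection \<open>Bottlenecks of the Metropolis chain\<close>

lemma measure_bind_pmf:
  "measure_pmf.prob (bind_pmf M f) S = (\<integral>x. measure_pmf.prob (f x) S \<partial>measure_pmf M)"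
  using pmf_bind[of M "\<lambda>x. map_pmf (\<lambda>y. y \<in> S) (f x)" True]
  by (simp add: map_bind_pmf[symmetric] pmf_map vimage_def)

text \<open>A rejected move stays at \<open>x\<close>, so away from the diagonal only accepted moves
  contribute, and the partition function cancels in the acceptance ratio. The sum over
  \<open>v\<close> is kept because its condition is symmetric in \<open>x\<close> and
  \<open>y\<close>.\<close>

lemma pmf_metropolis_step:
  assumes "0 < n" "y \<noteq> x"
  shows "pmf (metropolis_step n E h \<beta> x) y =
    (\<Sum>v<n. if sym_diff x {v} = y \<and> y \<in> cliques n E
            then min 1 (exp (\<beta> * (h (card y) - h (card x)))) else 0) / n"
proof -
  have ne: "{..<n} \<noteq> {}" using assms by auto
  have "pmf (if C \<in> cliques n E
       then do {
         accept \<leftarrow> bernoulli_pmf (min 1 (gibbs n E h \<beta> C / gibbs n E h \<beta> x));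
         return_pmf (if accept then C else x)
       } else return_pmf x) y =
     (if C = y \<and> y \<in> cliques n E
            then min 1 (exp (\<beta> * (h (card y) - h (card x)))) else 0)" for C
    using assms(2) by (cases "C = y") (auto simp: pmf_bind gibbs_ratio)
  then show ?thesis
    unfolding metropolis_step_def Let_def by (simp add: pmf_bind_pmf_of_set[OF ne])
qed

text \<open>Toggling a vertex is an involution, so the same \<open>v\<close> lead from
  \<open>x\<close> to \<open>y\<close> and back. Weight times acceptance probability is the minimum
  of the two weights, which is symmetric. Unnormalised weights suffice.\<close>

lemma metropolis_step_reversible:
  assumes "0 < n" "x \<in> cliques n E" "y \<in> cliques n E"
  shows "exp (\<beta> * h (card x)) * pmf (metropolis_step n E h \<beta> x) y =
         exp (\<beta> * h (card y)) * pmf (metropolis_step n E h \<beta> y) x"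
proof (cases "x = y")
  case False
  have sym: "sym_diff x {v} = y \<longleftrightarrow> sym_diff y {v} = x" for v by auto
  have m: "exp a * min 1 (exp (b - a)) = min (exp a) (exp b)" for a b :: real
    by (auto simp: min_def exp_diff)
  show ?thesis
    using assms False
    by (simp add: pmf_metropolis_step sum_distrib_left sym if_distrib[of "\<lambda>z. _ * z"]
          right_diff_distrib m min.commute cong: if_cong)
qed simp

lemma set_pmf_metropolis_step:
  assumes "0 < n" "y \<in> set_pmf (metropolis_step n E h \<beta> x)"
  shows "y = x \<or> y \<in> cliques n E \<and> (\<exists>v<n. y = sym_diff x {v})"
proof -
  have "{..<n} \<noteq> {}" using assms(1) by auto
  then have "set_pmf (pmf_of_set {..<n}) = {..<n}" by simp
  with assms(2) show ?thesis
    by (fastforce simp: metropolis_step_def Let_def split: if_splits)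
qed

lemma prob_metropolis_path_Suc:
  "measure_pmf.prob (metropolis_path n E h \<beta> (Suc T) x) S =
   (\<integral>y. measure_pmf.prob (metropolis_path n E h \<beta> T y) {Xs. x # Xs \<in> S}
     \<partial>measure_pmf (metropolis_step n E h \<beta> x))"
proof -
  have "metropolis_path n E h \<beta> T y \<bind> (\<lambda>Xs. return_pmf (x # Xs)) =
        map_pmf ((#) x) (metropolis_path n E h \<beta> T y)" for y
    by (simp add: map_pmf_def)
  then show ?thesis
    by (simp add: measure_bind_pmf vimage_def)
qed

text \<open>
  Summing over starting points weighted by the stationary measure makes every single step
  account for at most the stationary mass of the bottleneck \<open>B\<close>.
\<close>

lemma metropolis_escape_bound:
  assumes n: "0 < n" and A: "A \<subseteq> cliques n E" and B: "B \<subseteq> cliques n E" and AB: "A \<inter> B = {}"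
    and step: "\<And>x v. x \<in> A \<Longrightarrow> sym_diff x {v} \<in> cliques n E \<Longrightarrow> sym_diff x {v} \<in> A \<union> B"
  shows "(\<Sum>x\<in>A. exp (\<beta> * h (card x)) *
             measure_pmf.prob (metropolis_path n E h \<beta> T x) {Xs. \<not> set Xs \<subseteq> A})
         \<le> T * (\<Sum>x\<in>B. exp (\<beta> * h (card x)))"
proof (induction T)
  case 0
  then show ?case by (simp add: indicator_def)
next
  case (Suc T)
  let ?w = "\<lambda>x. exp (\<beta> * h (card x))"
  let ?K = "\<lambda>x. metropolis_step n E h \<beta> x"
  let ?H = "\<lambda>T x. measure_pmf.prob (metropolis_path n E h \<beta> T x) {Xs. \<not> set Xs \<subseteq> A}"
  have fin: "finite A" "finite B" "finite (A \<union> B)"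
    using A B finite_cliques finite_subset by blast+
  \<comment> \<open>First-step analysis: putting \<open>x\<close> in front of a trajectory does not
    affect whether it stays in \<open>A\<close>, and one step from \<open>A\<close> ends in
    \<open>A \<union> B\<close>.\<close>
  have H_Suc: "?H (Suc T) x = (\<Sum>y\<in>A \<union> B. ?H T y * pmf (?K x) y)" if "x \<in> A" for x
  proof -
    have "set_pmf (?K x) \<subseteq> A \<union> B"
      using set_pmf_metropolis_step[OF n] step[OF that] that by blast
    then have "(\<integral>y. ?H T y \<partial>measure_pmf (?K x)) = (\<Sum>y\<in>A \<union> B. ?H T y * pmf (?K x) y)"
      by (intro integral_measure_pmf_real fin) auto
    moreover have "{Xs. x # Xs \<in> {Xs. \<not> set Xs \<subseteq> A}} = {Xs. \<not> set Xs \<subseteq> A}"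
      using that by auto
    ultimately show ?thesis by (simp only: prob_metropolis_path_Suc)
  qed
  \<comment> \<open>By reversibility the mass flowing from \<open>A\<close> into \<open>y\<close>
    equals the mass flowing from \<open>y\<close> into \<open>A\<close>, which cannot exceed the
    weight of \<open>y\<close>.\<close>
  have flow: "(\<Sum>x\<in>A. ?w x * pmf (?K x) y) \<le> ?w y" if "y \<in> A \<union> B" for y
  proof -
    have "(\<Sum>x\<in>A. ?w x * pmf (?K x) y) = (\<Sum>x\<in>A. ?w y * pmf (?K y) x)"
      using metropolis_step_reversible[OF n] A B that by (intro sum.cong) (auto simp: subset_iff)
    also have "\<dots> = ?w y * measure_pmf.prob (?K y) A"
      by (simp add: measure_measure_pmf_finite fin sum_distrib_left)
    also have "\<dots> \<le> ?w y" by simp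
    finally show ?thesis .
  qed
  have "(\<Sum>x\<in>A. ?w x * ?H (Suc T) x) = (\<Sum>x\<in>A. \<Sum>y\<in>A \<union> B. ?H T y * (?w x * pmf (?K x) y))"
    by (intro sum.cong) (auto simp only: H_Suc sum_distrib_left mult_ac)
  also have "\<dots> = (\<Sum>y\<in>A \<union> B. ?H T y * (\<Sum>x\<in>A. ?w x * pmf (?K x) y))"
    by (subst sum.swap) (simp add: sum_distrib_left)
  also have "\<dots> \<le> (\<Sum>y\<in>A \<union> B. ?H T y * ?w y)"
    by (intro sum_mono mult_left_mono flow) auto
  also have "\<dots> = (\<Sum>y\<in>A. ?w y * ?H T y) + (\<Sum>y\<in>B. ?H T y * ?w y)"
    using fin AB by (simp add: sum.union_disjoint mult.commute)
  \<comment> \<open>On \<open>B\<close> the escape probability is bounded by one; this is the single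
    extra copy of the weight of \<open>B\<close> that each step costs.\<close>
  also have "(\<Sum>y\<in>B. ?H T y * ?w y) \<le> (\<Sum>y\<in>B. ?w y)"
    by (intro sum_mono mult_left_le_one_le) auto
  also note Suc.IH
  finally show ?case by (simp add: algebra_simps)
qed

text \<open>An averaging argument: if every start in \<open>A\<close> escaped with probability above
  \<open>T * \<rho>\<close>, the weighted sum of escape probabilities would exceed the bound of
  \<open>metropolis_escape_bound\<close>.\<close>

lemma metropolis_slow_start:
  assumes "0 < n" "A \<subseteq> cliques n E" "B \<subseteq> cliques n E" "A \<inter> B = {}" "A \<noteq> {}"
    and "\<And>x v. x \<in> A \<Longrightarrow> sym_diff x {v} \<in> cliques n E \<Longrightarrow> sym_diff x {v} \<in> A \<union> B"
    and \<rho>: "(\<Sum>x\<in>B. exp (\<beta> * h (card x))) \<le> \<rho> * (\<Sum>x\<in>A. exp (\<beta> * h (card x)))"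
  shows "\<exists>x\<in>A. measure_pmf.prob (metropolis_path n E h \<beta> T x) {Xs. \<not> set Xs \<subseteq> A} \<le> T * \<rho>"
proof (rule ccontr)
  let ?w = "\<lambda>x. exp (\<beta> * h (card x))"
  let ?H = "\<lambda>x. measure_pmf.prob (metropolis_path n E h \<beta> T x) {Xs. \<not> set Xs \<subseteq> A}"
  assume "\<not> ?thesis"
  then have gt: "?H x > T * \<rho>" if "x \<in> A" for x
    using that by auto
  have "finite A" using assms(2) finite_cliques finite_subset by blast
  then have "(\<Sum>x\<in>A. ?w x * (T * \<rho>)) < (\<Sum>x\<in>A. ?w x * ?H x)"
    using assms(5) gt by (intro sum_strict_mono) auto
  also have "\<dots> \<le> T * (\<Sum>x\<in>B. ?w x)"
    by (rule metropolis_escape_bound[OF assms(1-4,6)])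
  also have "\<dots> \<le> T * (\<rho> * (\<Sum>x\<in>A. ?w x))"
    using \<rho> by (intro mult_left_mono) auto
  finally show False by (simp add: sum_distrib_left sum_distrib_right mult_ac)
qed

text \<open>The weight is constant on each layer of sets of equal size, so comparing the layer sizes
  is enough. This removes all dependence on the Gibbs weight from the graph condition.\<close>

lemma sum_le_if_card_layers_le:
  fixes f :: "nat \<Rightarrow> real"
  assumes "finite A" "finite B" "\<And>q. f q \<ge> 0" "\<And>x. x \<in> A \<Longrightarrow> card x \<le> n" "\<And>x. x \<in> B \<Longrightarrow> card x \<le> n"
    and "\<And>q. real (card {x\<in>B. card x = q}) \<le> \<rho> * real (card {x\<in>A. card x = q})"
  shows "(\<Sum>x\<in>B. f (card x)) \<le> \<rho> * (\<Sum>x\<in>A. f (card x))"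
proof -
  have layer: "(\<Sum>x\<in>S. f (card x)) = (\<Sum>q\<le>n. real (card {x\<in>S. card x = q}) * f q)"
    if "finite S" "\<And>x. x \<in> S \<Longrightarrow> card x \<le> n" for S
  proof -
    have "(\<Sum>x\<in>S. f (card x)) = (\<Sum>q\<le>n. \<Sum>x\<in>{x\<in>S. card x = q}. f (card x))"
      using that by (intro sum.group[symmetric]) auto
    then show ?thesis by simp
  qed
  have "(\<Sum>x\<in>B. f (card x)) = (\<Sum>q\<le>n. real (card {x\<in>B. card x = q}) * f q)"
    by (rule layer) (use assms in auto)
  also have "\<dots> \<le> (\<Sum>q\<le>n. \<rho> * real (card {x\<in>A. card x = q}) * f q)"
    by (intro sum_mono mult_right_mono assms)
  also have "\<dots> = \<rho> * (\<Sum>q\<le>n. real (card {x\<in>A. card x = q}) * f q)"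
    by (simp add: sum_distrib_left mult_ac)
  also have "(\<Sum>q\<le>n. real (card {x\<in>A. card x = q}) * f q) = (\<Sum>x\<in>A. f (card x))"
    by (rule layer[symmetric]) (use assms in auto)
  finally show ?thesis .
qed

subsection \<open>Clique counts in the random graph\<close>

lemma clique_iff_nsets_subset: "clique C E \<longleftrightarrow> nsets C 2 \<subseteq> E"
  by (auto simp: clique_def nsets_2_eq)

lemma nsets_Int: "nsets A q \<inter> nsets B q = nsets (A \<inter> B) q"
  by (auto simp: nsets_def)

lemma finite_set_random_graph: "finite (set_pmf (random_graph n))"
  by (rule finite_subset[of _ "Pow (nsets {..<n} 2)"])
     (auto simp: random_graph_def finite_imp_finite_nsets)

text \<open>Independence of the pairs: the event is a product set whose factor is \<open>1/2\<close>
  for each required pair and \<open>1\<close> for every other pair.\<close>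

lemma prob_random_graph_superset:
  assumes "S \<subseteq> nsets {..<n} 2"
  shows "measure_pmf.prob (random_graph n) {E. S \<subseteq> E} = (1/2) ^ card S"
proof -
  let ?A = "nsets {..<n} 2" and ?B = "\<lambda>e. if e \<in> S then {True} else UNIV"
  have fin: "finite ?A" by (simp add: finite_imp_finite_nsets)
  have "(\<lambda>f. {e \<in> ?A. f e}) -` {E. S \<subseteq> E} = Pi ?A ?B"
    using assms by (auto simp: Pi_def)
  then have "measure_pmf.prob (random_graph n) {E. S \<subseteq> E} =
      (\<Prod>e\<in>?A. measure_pmf.prob (bernoulli_pmf (1/2)) (?B e))"
    by (simp add: random_graph_def measure_Pi_pmf_Pi[OF fin])
  also have "\<dots> = (\<Prod>e\<in>?A. if e \<in> S then 1/2 else 1)"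
    by (intro prod.cong) (auto simp: measure_pmf_single)
  also have "\<dots> = (1/2) ^ card S"
    using fin assms by (simp add: prod.If_cases Int_absorb1)
  finally show ?thesis .
qed

text \<open>Linearity of expectation. The family \<open>S\<close> is abstract so that it covers both
  all pairs of a vertex set and only its unplanted pairs.\<close>

lemma expectation_random_graph_count:
  assumes "finite F" "\<And>i. i \<in> F \<Longrightarrow> S i \<subseteq> nsets {..<n} 2"
  shows "measure_pmf.expectation (random_graph n) (\<lambda>E. real (card {i\<in>F. S i \<subseteq> E})) =
         (\<Sum>i\<in>F. (1/2) ^ card (S i))"
proof -
  have "(\<lambda>E. real (card {i\<in>F. S i \<subseteq> E})) = (\<lambda>E. \<Sum>i\<in>F. indicator {E. S i \<subseteq> E} E)"
    using assms(1) by (simp add: indicator_def sum.If_cases Int_def)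
  then show ?thesis
    using assms
    by (simp add: Bochner_Integration.integral_sum integrable_measure_pmf_finite
        finite_set_random_graph prob_random_graph_superset)
qed

text \<open>The square counts ordered pairs of indices, and both sets are present iff their union
  is, so the first-moment formula applies to the product family.\<close>

lemma expectation_random_graph_count_squared:
  assumes "finite F" "\<And>i. i \<in> F \<Longrightarrow> S i \<subseteq> nsets {..<n} 2"
  shows "measure_pmf.expectation (random_graph n) (\<lambda>E. (real (card {i\<in>F. S i \<subseteq> E}))\<^sup>2) =
         (\<Sum>i\<in>F. \<Sum>j\<in>F. (1/2) ^ card (S i \<union> S j))"
proof -
  have sq: "(real (card {i\<in>F. S i \<subseteq> E}))\<^sup>2 =
        real (card {p \<in> F \<times> F. S (fst p) \<union> S (snd p) \<subseteq> E})" for E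
  proof -
    have "{p \<in> F \<times> F. S (fst p) \<union> S (snd p) \<subseteq> E} = {i\<in>F. S i \<subseteq> E} \<times> {i\<in>F. S i \<subseteq> E}"
      by auto
    then show ?thesis by (simp add: power2_eq_square card_cartesian_product)
  qed
  have "S (fst p) \<union> S (snd p) \<subseteq> nsets {..<n} 2" if "p \<in> F \<times> F" for p
    using assms(2)[of "fst p"] assms(2)[of "snd p"] that by auto
  then show ?thesis
    unfolding sq using assms(1)
    by (subst expectation_random_graph_count) (auto simp: sum.cartesian_product case_prod_unfold)
qed

lemma prob_random_graph_count_ge:
  assumes "finite F" "\<And>i. i \<in> F \<Longrightarrow> S i \<subseteq> nsets {..<n} 2" "0 < a"
  shows "measure_pmf.prob (random_graph n) {E. real (card {i\<in>F. S i \<subseteq> E}) \<ge> a} \<le>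
         (\<Sum>i\<in>F. (1/2) ^ card (S i)) / a"
proof -
  have "measure_pmf.prob (random_graph n)
      {E\<in>space (random_graph n). real (card {i\<in>F. S i \<subseteq> E}) \<ge> a} \<le>
      measure_pmf.expectation (random_graph n) (\<lambda>E. real (card {i\<in>F. S i \<subseteq> E})) / a"
    by (rule integral_Markov_inequality_measure[where A = "{}"])
       (auto simp: assms integrable_measure_pmf_finite finite_set_random_graph)
  then show ?thesis using assms by (simp add: expectation_random_graph_count)
qed

section \<open>Second moment method for unplanted cliques\<close>

text \<open>Up to the factor \<open>N choose q\<close> this bounds the probability that a random
  \<open>q\<close>-subset of an \<open>N\<close>-set contains \<open>i\<close> given elements. Each
  further element costs \<open>(q - i) / (N - i)\<close>, which is at most \<open>q / N\<close>
  because \<open>q \<le> N\<close>.\<close>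

lemma binomial_diff_le:
  assumes "i \<le> q" "q \<le> N"
  shows "real ((N - i) choose (q - i)) \<le> real (N choose q) * (real q / real N) ^ i"
  using assms(1)
proof (induction i)
  case (Suc i)
  then have i: "i < q" "i < N" "q - i = Suc (q - Suc i)" "N - i = Suc (N - Suc i)"
    using assms(2) by auto
  have "Suc (q - Suc i) * (Suc (N - Suc i) choose Suc (q - Suc i)) =
        Suc (N - Suc i) * ((N - Suc i) choose (q - Suc i))"
    by (rule Suc_times_binomial)
  then have "(q - i) * ((N - i) choose (q - i)) = (N - i) * ((N - Suc i) choose (q - Suc i))"
    using i by metis
  then have "real (q - i) * real ((N - i) choose (q - i)) =
             real (N - i) * real ((N - Suc i) choose (q - Suc i))"
    by (metis of_nat_mult)
  moreover have "z = y * (a / b)" if "a * y = b * z" "b > 0" for a b y z :: real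
    using that by (simp add: field_simps)
  ultimately have "real ((N - Suc i) choose (q - Suc i)) =
      real ((N - i) choose (q - i)) * (real (q - i) / real (N - i))"
    using i(2) by (metis of_nat_0_less_iff zero_less_diff)
  also have "\<dots> \<le> (real (N choose q) * (real q / real N) ^ i) * (real q / real N)"
  proof (intro mult_mono)
    have "real q * real i \<le> real N * real i" using assms(2) by (intro mult_right_mono) auto
    then show "real (q - i) / real (N - i) \<le> real q / real N"
      using i assms(2) by (simp add: field_simps of_nat_diff)
  qed (use Suc in auto)
  finally show ?case by (simp add: mult_ac)
qed simp

text \<open>Such a set \<open>D\<close> is recovered from \<open>D - I\<close>, a subset of
  \<open>V - I\<close> with \<open>q - card I\<close> elements.\<close>

lemma card_nsets_superset_le:
  assumes "finite V" "I \<subseteq> V"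
  shows "card {D \<in> nsets V q. I \<subseteq> D} \<le> (card V - card I) choose (q - card I)"
proof -
  have "finite I" using assms finite_subset by blast
  have "D \<in> (\<union>) I ` nsets (V - I) (q - card I)" if "D \<in> nsets V q" "I \<subseteq> D" for D
  proof (rule image_eqI)
    show "D = I \<union> (D - I)" using that by auto
    show "D - I \<in> nsets (V - I) (q - card I)"
      using that \<open>finite I\<close> by (auto simp: nsets_def card_Diff_subset)
  qed
  then have "{D \<in> nsets V q. I \<subseteq> D} \<subseteq> (\<union>) I ` nsets (V - I) (q - card I)"
    by blast
  then have "card {D \<in> nsets V q. I \<subseteq> D} \<le> card (nsets (V - I) (q - card I))"
    by (rule surj_card_le[rotated]) (simp add: finite_imp_finite_nsets assms)
  then show ?thesis
    using assms \<open>finite I\<close> by (simp add: card_Diff_subset)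
qed

text \<open>
  Expanding \<open>a ^ m = ((a - 1) + 1) ^ m\<close> over subsets of the intersection turns the sum into
  one over subsets \<open>I\<close> of \<open>C\<close>, and a random \<open>q\<close>-set contains \<open>I\<close> with probability at most \<open>(q / N) ^ card I\<close>.
\<close>

lemma sum_power_card_Int_le:
  fixes a :: real
  assumes V: "finite V" "q \<le> card V" and C: "C \<in> nsets V q" and a: "1 \<le> a"
  shows "(\<Sum>D\<in>nsets V q. a ^ card (C \<inter> D)) \<le>
         real (card V choose q) * (1 + (a - 1) * (real q / real (card V))) ^ q"
proof -
  have binom: "(x + 1) ^ card I = (\<Sum>J\<in>Pow I. x ^ card J)" if "finite I" for x :: real and I :: "'a set"
    using prod_add[OF that, of "\<lambda>_. x" "\<lambda>_. 1"] by simp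
  have C': "C \<subseteq> V" "finite C" "card C = q" using C by (auto simp: nsets_def)
  have fin: "finite (nsets V q)" using V by (simp add: finite_imp_finite_nsets)
  have "(\<Sum>D\<in>nsets V q. a ^ card (C \<inter> D)) = (\<Sum>D\<in>nsets V q. \<Sum>I\<in>{I\<in>Pow C. I \<subseteq> D}. (a - 1) ^ card I)"
  proof (intro sum.cong refl)
    fix D
    have "{I\<in>Pow C. I \<subseteq> D} = Pow (C \<inter> D)" by auto
    then show "a ^ card (C \<inter> D) = (\<Sum>I\<in>{I\<in>Pow C. I \<subseteq> D}. (a - 1) ^ card I)"
      using binom[of "C \<inter> D" "a - 1"] C' by simp
  qed
  \<comment> \<open>Exchanging the sums leaves, for each fixed \<open>I\<close>, only the number of
    \<open>q\<close>-sets that contain it.\<close>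
  also have "\<dots> = (\<Sum>I\<in>Pow C. \<Sum>D\<in>{D\<in>nsets V q. I \<subseteq> D}. (a - 1) ^ card I)"
    using fin C' by (intro sum.swap_restrict) auto
  also have "\<dots> = (\<Sum>I\<in>Pow C. real (card {D\<in>nsets V q. I \<subseteq> D}) * (a - 1) ^ card I)"
    by simp
  also have "\<dots> \<le> (\<Sum>I\<in>Pow C. (real (card V choose q) * (real q / real (card V)) ^ card I) * (a - 1) ^ card I)"
  proof (intro sum_mono mult_right_mono)
    fix I assume "I \<in> Pow C"
    then have "I \<subseteq> V" "card I \<le> q" using C' card_mono by auto
    then show "real (card {D\<in>nsets V q. I \<subseteq> D}) \<le>
        real (card V choose q) * (real q / real (card V)) ^ card I"
      using card_nsets_superset_le[OF V(1), of I q] binomial_diff_le[OF _ V(2), of "card I"]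
      by (meson of_nat_mono order_trans)
  qed (use a in auto)
  also have "\<dots> = real (card V choose q) * (\<Sum>I\<in>Pow C. ((a - 1) * (real q / real (card V))) ^ card I)"
    by (simp only: sum_distrib_left power_mult_distrib mult_ac)
  also have "(\<Sum>I\<in>Pow C. ((a - 1) * (real q / real (card V))) ^ card I) =
      (1 + (a - 1) * (real q / real (card V))) ^ q"
    using binom[OF C'(2), of "(a - 1) * (real q / real (card V))"] by (simp only: C'(3) add.commute)
  finally show ?thesis .
qed

lemma choose_two_real: "real (m choose 2) = real m * (real m - 1) / 2"
proof -
  have "real (m choose 2) = real (m * (m - 1)) / 2"
    by (subst choose_two, subst real_of_nat_div) auto
  then show ?thesis by (cases m) (auto simp: algebra_simps)
qed

text \<open>Two \<open>q\<close>-sets meeting in \<open>m\<close> vertices share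
  \<open>m choose 2\<close> pairs, so the probability that both are cliques is the product of the
  two probabilities times \<open>2 ^ (m choose 2)\<close>. Bounding this correlation by a pure power
  of \<open>m\<close> reduces the double sum to \<open>sum_power_card_Int_le\<close>.\<close>

lemma clique_count_second_moment:
  assumes V: "V \<subseteq> {..<n}" "q \<le> card V"
  defines "\<mu> \<equiv> real (card V choose q) * (1/2) ^ (q choose 2)"
  shows "measure_pmf.expectation (random_graph n) (\<lambda>E. real (card {C\<in>nsets V q. nsets C 2 \<subseteq> E})) = \<mu>"
    and "measure_pmf.expectation (random_graph n) (\<lambda>E. (real (card {C\<in>nsets V q. nsets C 2 \<subseteq> E}))\<^sup>2)
         \<le> \<mu>\<^sup>2 * exp (2 powr (real q / 2) * (real q)\<^sup>2 / real (card V))"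
proof -
  have finV: "finite V" using V finite_subset by blast
  have fin: "finite (nsets V q)" using finV by (simp add: finite_imp_finite_nsets)
  have sub: "nsets C 2 \<subseteq> nsets {..<n} 2" if "C \<in> nsets V q" for C
    using that V by (intro nsets_mono) (auto simp: nsets_def)
  have card2: "card (nsets C 2) = q choose 2" if "C \<in> nsets V q" for C
  proof -
    have "card C = q" using that by (simp add: nsets_def)
    then show ?thesis by simp
  qed
  show "measure_pmf.expectation (random_graph n) (\<lambda>E. real (card {C\<in>nsets V q. nsets C 2 \<subseteq> E})) = \<mu>"
  proof -
    have "(\<Sum>C\<in>nsets V q. (1/2::real) ^ card (nsets C 2)) = (\<Sum>C\<in>nsets V q. (1/2) ^ (q choose 2))"
      by (intro sum.cong) (simp_all only: card2)
    then show ?thesis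
      using expectation_random_graph_count[OF fin sub] by (simp add: \<mu>_def)
  qed
  \<comment> \<open>Since \<open>m \<le> q\<close>, the exponent \<open>m choose 2\<close> is at
    most \<open>m * q / 2\<close>; the base \<open>a\<close> makes the correlation factor at most
    \<open>a ^ m\<close>.\<close>
  define a where "a = 2 powr (real q / 2)"
  have a1: "a \<ge> 1" by (simp add: a_def ge_one_powr_ge_zero)
  have inner: "(\<Sum>D\<in>nsets V q. (1/2) ^ card (nsets C 2 \<union> nsets D 2)) \<le>
      ((1/2) ^ (q choose 2))\<^sup>2 * (real (card V choose q) * exp (a * (real q)\<^sup>2 / real (card V)))"
    if C: "C \<in> nsets V q" for C
  proof -
    have "(1/2) ^ card (nsets C 2 \<union> nsets D 2) \<le> ((1/2) ^ (q choose 2))\<^sup>2 * a ^ card (C \<inter> D)"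
      if D: "D \<in> nsets V q" for D
    proof -
      let ?m = "card (C \<inter> D)"
      have fCD: "finite C" "finite D" "card C = q" "card D = q" using C D by (auto simp: nsets_def)
      have "?m \<le> q" using card_mono[of C "C \<inter> D"] fCD by auto
      have "card (nsets C 2) + card (nsets D 2) =
            card (nsets C 2 \<union> nsets D 2) + card (nsets C 2 \<inter> nsets D 2)"
        using fCD by (intro card_Un_Int) (auto simp: finite_imp_finite_nsets)
      then have eq: "2 * (q choose 2) = card (nsets C 2 \<union> nsets D 2) + (?m choose 2)"
        using fCD by (simp add: nsets_Int)
      have "((1/2::real) ^ (q choose 2))\<^sup>2 = (1/2) ^ card (nsets C 2 \<union> nsets D 2) * (1/2) ^ (?m choose 2)"
        by (simp only: power_mult[symmetric] mult.commute[of _ 2] eq power_add)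
      then have "(1/2::real) ^ card (nsets C 2 \<union> nsets D 2) = ((1/2) ^ (q choose 2))\<^sup>2 * 2 ^ (?m choose 2)"
        by (simp add: power_one_over)
      also have "2 ^ (?m choose 2) \<le> a ^ ?m"
      proof -
        have "real (?m choose 2) \<le> real q / 2 * real ?m"
          using \<open>?m \<le> q\<close> by (simp add: choose_two_real mult.commute[of "real q"] mult_left_mono)
        then have "2 powr real (?m choose 2) \<le> 2 powr (real q / 2 * real ?m)"
          by simp
        then show ?thesis by (simp add: a_def powr_power powr_realpow mult.commute)
      qed
      finally show ?thesis by (simp add: mult_left_mono)
    qed
    then have "(\<Sum>D\<in>nsets V q. (1/2) ^ card (nsets C 2 \<union> nsets D 2)) \<le>
        ((1/2) ^ (q choose 2))\<^sup>2 * (\<Sum>D\<in>nsets V q. a ^ card (C \<inter> D))"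
      unfolding sum_distrib_left by (rule sum_mono)
    also have "(\<Sum>D\<in>nsets V q. a ^ card (C \<inter> D)) \<le>
        real (card V choose q) * (1 + (a - 1) * (real q / real (card V))) ^ q"
      by (rule sum_power_card_Int_le[OF finV V(2) C a1])
    also have "(1 + (a - 1) * (real q / real (card V))) ^ q \<le> exp (a * (real q / real (card V))) ^ q"
    proof (rule power_mono)
      show "0 \<le> 1 + (a - 1) * (real q / real (card V))" using a1 by auto
      have "1 + (a - 1) * (real q / real (card V)) \<le> 1 + a * (real q / real (card V))"
        by (intro add_left_mono mult_right_mono) auto
      also have "\<dots> \<le> exp (a * (real q / real (card V)))"
        by (rule exp_ge_add_one_self)
      finally show "1 + (a - 1) * (real q / real (card V)) \<le> exp (a * (real q / real (card V)))" .
    qed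
    also have "\<dots> = exp (a * (real q)\<^sup>2 / real (card V))"
      by (simp add: exp_of_nat_mult[symmetric] power2_eq_square mult_ac)
    finally show ?thesis by (simp add: mult_left_mono)
  qed
  have "measure_pmf.expectation (random_graph n) (\<lambda>E. (real (card {C\<in>nsets V q. nsets C 2 \<subseteq> E}))\<^sup>2)
      = (\<Sum>C\<in>nsets V q. \<Sum>D\<in>nsets V q. (1/2) ^ card (nsets C 2 \<union> nsets D 2))"
    by (rule expectation_random_graph_count_squared[OF fin sub])
  also have "\<dots> \<le> (\<Sum>C\<in>nsets V q. ((1/2) ^ (q choose 2))\<^sup>2 *
      (real (card V choose q) * exp (a * (real q)\<^sup>2 / real (card V))))"
    by (intro sum_mono inner)
  also have "\<dots> = \<mu>\<^sup>2 * exp (a * (real q)\<^sup>2 / real (card V))"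
    by (simp add: \<mu>_def power_mult_distrib power2_eq_square mult_ac)
  finally show "measure_pmf.expectation (random_graph n) (\<lambda>E. (real (card {C\<in>nsets V q. nsets C 2 \<subseteq> E}))\<^sup>2)
         \<le> \<mu>\<^sup>2 * exp (2 powr (real q / 2) * (real q)\<^sup>2 / real (card V))"
    by (simp add: a_def)
qed

text \<open>Chebyshev at distance \<open>\<mu> / 2\<close> from the mean: the second moment bounds
  the variance by \<open>\<mu>\<close> squared times the exponential minus one, and dividing by the
  squared distance gives the factor 4.\<close>

lemma prob_clique_count_small:
  assumes V: "V \<subseteq> {..<n}" "q \<le> card V"
  defines "\<mu> \<equiv> real (card V choose q) * (1/2) ^ (q choose 2)"
  shows "measure_pmf.prob (random_graph n) {E. real (card {C\<in>nsets V q. nsets C 2 \<subseteq> E}) \<le> \<mu> / 2}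
         \<le> 4 * (exp (2 powr (real q / 2) * (real q)\<^sup>2 / real (card V)) - 1)"
proof -
  let ?Z = "\<lambda>E. real (card {C\<in>nsets V q. nsets C 2 \<subseteq> E})"
  let ?e = "exp (2 powr (real q / 2) * (real q)\<^sup>2 / real (card V))"
  have \<mu>: "\<mu> > 0" using V by (simp add: \<mu>_def)
  have int: "integrable (measure_pmf (random_graph n)) f" for f :: "nat set set \<Rightarrow> real"
    by (simp add: integrable_measure_pmf_finite finite_set_random_graph)
  have mean: "measure_pmf.expectation (random_graph n) ?Z = \<mu>"
    using clique_count_second_moment(1)[OF V] by (simp add: \<mu>_def)
  have sq: "measure_pmf.expectation (random_graph n) (\<lambda>E. (?Z E)\<^sup>2) \<le> \<mu>\<^sup>2 * ?e"
    using clique_count_second_moment(2)[OF V] by (simp add: \<mu>_def)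
  have "measure_pmf.prob (random_graph n) {E. ?Z E \<le> \<mu> / 2} \<le>
        measure_pmf.prob (random_graph n) {E \<in> space (random_graph n). \<bar>?Z E - \<mu>\<bar> \<ge> \<mu> / 2}"
    by (rule measure_pmf.finite_measure_mono) auto
  also have "\<dots> \<le> measure_pmf.variance (random_graph n) ?Z / (\<mu> / 2)\<^sup>2"
    using measure_pmf.Chebyshev_inequality[of ?Z "random_graph n" "\<mu> / 2"] int \<mu> by (simp add: mean)
  also have "measure_pmf.variance (random_graph n) ?Z \<le> \<mu>\<^sup>2 * ?e - \<mu>\<^sup>2"
    using measure_pmf.variance_eq[where X = ?Z, OF int int] mean sq by simp
  also have "(\<mu>\<^sup>2 * ?e - \<mu>\<^sup>2) / (\<mu> / 2)\<^sup>2 = 4 * (?e - 1)"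
    using \<mu> by (simp add: field_simps power2_eq_square)
  finally show ?thesis by (simp add: divide_right_mono)
qed

section \<open>First moment of cliques with prescribed planted intersection\<close>

text \<open>The pairs inside \<open>P\<close> are planted, so only \<open>(q choose 2) - (r choose 2)\<close> pairs must be sampled.\<close>

lemma planted_clique_first_moment:
  assumes P: "P \<subseteq> {..<n}" and a: "0 < a"
  shows "measure_pmf.prob (random_graph n)
      {E. real (card {C\<in>nsets {..<n} q. card (C \<inter> P) = r \<and> clique C (E \<union> nsets P 2)}) \<ge> a} \<le>
     real (card P choose r) * real ((n - card P) choose (q - r)) * (1/2) ^ ((q choose 2) - (r choose 2)) / a"
proof -
  have finP: "finite P" using P finite_subset by blast
  let ?F = "{C\<in>nsets {..<n} q. card (C \<inter> P) = r}"
  have fin: "finite ?F" by (simp add: finite_imp_finite_nsets)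
  \<comment> \<open>\<open>C\<close> is determined by its planted part of size \<open>r\<close> and
    its unplanted part of size \<open>q - r\<close>.\<close>
  have "C \<in> (\<lambda>(A, B). A \<union> B) ` (nsets P r \<times> nsets ({..<n} - P) (q - r))"
    if "C \<in> ?F" for C
  proof (rule image_eqI)
    show "C = (\<lambda>(A, B). A \<union> B) (C \<inter> P, C - P)" by auto
    have "card (C - P) = card C - card (C \<inter> P)" using that by (intro card_Diff_subset_Int) (auto simp: nsets_def)
    then show "(C \<inter> P, C - P) \<in> nsets P r \<times> nsets ({..<n} - P) (q - r)"
      using that finP by (auto simp: nsets_def)
  qed
  then have "?F \<subseteq> (\<lambda>(A, B). A \<union> B) ` (nsets P r \<times> nsets ({..<n} - P) (q - r))" by blast
  then have "card ?F \<le> card (nsets P r \<times> nsets ({..<n} - P) (q - r))"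
    by (rule surj_card_le[rotated]) (simp add: finite_imp_finite_nsets finP)
  then have cardF: "card ?F \<le> (card P choose r) * ((n - card P) choose (q - r))"
    using P finP by (simp add: card_cartesian_product card_Diff_subset)
  have sub: "nsets C 2 - nsets P 2 \<subseteq> nsets {..<n} 2" if "C \<in> ?F" for C
    using that by (auto simp: nsets_def)
  \<comment> \<open>The pairs of \<open>C\<close> that are planted are exactly the pairs of
    \<open>C \<inter> P\<close>.\<close>
  have card2: "card (nsets C 2 - nsets P 2) = (q choose 2) - (r choose 2)" if "C \<in> ?F" for C
    using that finP finite_subset[of C "{..<n}"]
    by (auto simp: card_Diff_subset_Int finite_imp_finite_nsets nsets_Int nsets_def[of "{..<n}"])
  have "{C\<in>nsets {..<n} q. card (C \<inter> P) = r \<and> clique C (E \<union> nsets P 2)} =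
        {C\<in>?F. nsets C 2 - nsets P 2 \<subseteq> E}" for E
    by (auto simp: clique_iff_nsets_subset)
  then have "measure_pmf.prob (random_graph n)
      {E. real (card {C\<in>nsets {..<n} q. card (C \<inter> P) = r \<and> clique C (E \<union> nsets P 2)}) \<ge> a} \<le>
      (\<Sum>C\<in>?F. (1/2) ^ card (nsets C 2 - nsets P 2)) / a"
    using prob_random_graph_count_ge[OF fin sub a] by simp
  also have "(\<Sum>C\<in>?F. (1/2) ^ card (nsets C 2 - nsets P 2)) =
      real (card ?F) * (1/2) ^ ((q choose 2) - (r choose 2))"
    by (subst sum.cong[OF refl, of _ _ "\<lambda>_. (1/2) ^ ((q choose 2) - (r choose 2))"]) (use card2 in auto)
  also have "\<dots> \<le> real ((card P choose r) * ((n - card P) choose (q - r))) * (1/2) ^ ((q choose 2) - (r choose 2))"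
    using cardF by (intro mult_right_mono of_nat_mono) auto
  finally show ?thesis using a by (simp add: divide_right_mono)
qed

subsection \<open>The intersection bottleneck\<close>

text \<open>Toggling one vertex raises the intersection with \<open>P\<close> by at most one, so
  intersection exactly \<open>r\<close> separates the smaller intersections from the larger ones.
  The empty clique makes the starting side nonempty because \<open>0 < r\<close>.\<close>

lemma metropolis_clique_bottleneck:
  assumes "0 < n" "0 < r"
    and \<rho>: "\<And>q. real (card {C\<in>cliques n E. card (C \<inter> P) = r \<and> card C = q}) \<le>
         \<rho> * real (card {C\<in>cliques n E. card (C \<inter> P) < r \<and> card C = q})"
  shows "\<exists>x\<in>cliques n E. measure_pmf.prob (metropolis_path n E h \<beta> T x)
           {Xs. \<exists>C\<in>set Xs. r \<le> card (C \<inter> P)} \<le> T * \<rho>"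
proof -
  let ?A = "{C\<in>cliques n E. card (C \<inter> P) < r}" and ?B = "{C\<in>cliques n E. card (C \<inter> P) = r}"
  have fin: "finite ?A" "finite ?B" by (auto intro: finite_subset[OF _ finite_cliques])
  have size: "card C \<le> n" if "C \<in> cliques n E" for C
    using that card_mono[of "{..<n}" C] by (auto simp: cliques_def)
  have "(\<Sum>x\<in>?B. exp (\<beta> * h (card x))) \<le> \<rho> * (\<Sum>x\<in>?A. exp (\<beta> * h (card x)))"
    by (rule sum_le_if_card_layers_le[OF fin, where f = "\<lambda>q. exp (\<beta> * h q)"])
       (use \<rho> size in \<open>auto simp: conj_assoc\<close>)
  moreover have "sym_diff x {v} \<in> ?A \<union> ?B"
    if "x \<in> ?A" "sym_diff x {v} \<in> cliques n E" for x v
  proof -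
    have "finite x" using that(1) finite_subset[of x "{..<n}"] by (auto simp: cliques_def)
    then have "card (sym_diff x {v} \<inter> P) \<le> card (insert v (x \<inter> P))"
      by (intro card_mono) auto
    also have "\<dots> \<le> Suc (card (x \<inter> P))" by (simp add: card_insert_le_m1 card_insert_if \<open>finite x\<close>)
    finally show ?thesis using that by auto
  qed
  moreover have "?A \<noteq> {}" using empty_in_cliques \<open>0 < r\<close> by fastforce
  ultimately obtain x where x: "x \<in> ?A"
    "measure_pmf.prob (metropolis_path n E h \<beta> T x) {Xs. \<not> set Xs \<subseteq> ?A} \<le> T * \<rho>"
    using metropolis_slow_start[of n ?A E ?B \<beta> h \<rho> T] \<open>0 < n\<close> by auto
  have "measure_pmf.prob (metropolis_path n E h \<beta> T x) {Xs. \<exists>C\<in>set Xs. r \<le> card (C \<inter> P)} \<le>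
        measure_pmf.prob (metropolis_path n E h \<beta> T x) {Xs. \<not> set Xs \<subseteq> ?A}"
    by (rule measure_pmf.finite_measure_mono) auto
  with x show ?thesis by (intro bexI[of _ x]) auto
qed

text \<open>
  Replacing the \<open>r\<close> planted vertices of a clique by unplanted ones gains a factor \<open>(n - k) / (k q)\<close>
  each, at the price of the \<open>r choose 2\<close> planted edges.
\<close>

lemma binomial_layer_ratio:
  assumes "r \<le> q" "q < m"
  shows "real (k choose r) * real (m choose (q - r)) * (1/2) ^ ((q choose 2) - (r choose 2)) \<le>
    (real k * real q / real (m - q)) ^ r * 2 ^ (r choose 2) *
      (real (m choose q) * (1/2) ^ (q choose 2))"
proof -
  \<comment> \<open>Removing one vertex at a time from \<open>q\<close> down to
    \<open>q - i\<close>: with \<open>j < q\<close> every ratio of neighbouring binomials is at most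
    \<open>q / (m - q)\<close>.\<close>
  have *: "real (m choose (q - i)) \<le> (real q / real (m - q)) ^ i * real (m choose q)" if "i \<le> r" for i
    using that
  proof (induction i)
    case (Suc i)
    then obtain j where j: "q - i = Suc j" "q - Suc i = j" "j < q"
      using assms by (metis Suc_diff_Suc diff_less_Suc le_less_trans less_le_trans lessI not_less_eq)
    have "Suc j * (m choose Suc j) = (m - j) * (m choose j)"
      by (metis binomial_absorb_comp binomial_absorption mult.commute)
    then have "real (m - j) * real (m choose j) = real (Suc j) * real (m choose Suc j)"
      by (metis of_nat_mult)
    moreover have "real (m - q) * real (m choose j) \<le> real (m - j) * real (m choose j)"
      using j(3) by (intro mult_right_mono) auto
    moreover have "real (Suc j) * real (m choose Suc j) \<le> real q * real (m choose Suc j)"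
      using j(3) by (intro mult_right_mono) auto
    ultimately have "real (m choose j) \<le> (real q / real (m - q)) * real (m choose Suc j)"
      using assms by (simp add: field_simps)
    also have "\<dots> \<le> (real q / real (m - q)) * ((real q / real (m - q)) ^ i * real (m choose q))"
      using Suc j by (intro mult_left_mono) auto
    finally show ?case using j by (simp add: mult_ac)
  qed simp
  have "(k choose r) \<le> k ^ r"
    by (cases "r \<le> k") (auto simp: binomial_le_pow binomial_eq_0)
  then have "real (k choose r) \<le> real k ^ r"
    by (metis of_nat_le_iff of_nat_power)
  then have *: "real (k choose r) * real (m choose (q - r)) \<le>
      real k ^ r * ((real q / real (m - q)) ^ r * real (m choose q))"
    using *[of r] by (intro mult_mono) auto
  \<comment> \<open>The truncated subtraction is exact here, since \<open>r \<le> q\<close> gives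
    \<open>r choose 2\<close> at most \<open>q choose 2\<close>.\<close>
  have "(1/2::real) ^ ((q choose 2) - (r choose 2)) = 2 ^ (r choose 2) * (1/2) ^ (q choose 2)"
    using binomial_right_mono[OF assms(1), of 2] by (simp add: power_diff power_one_over field_simps)
  then show ?thesis
    using mult_right_mono[OF *, of "2 ^ (r choose 2) * (1/2) ^ (q choose 2)"]
    by (simp add: power_mult_distrib power_divide mult_ac)
qed

section \<open>Comparison of all layers with high probability\<close>

text \<open>A union bound over three kinds of failure, matching the three error terms: some layer
  from \<open>r\<close> to \<open>Q\<close> has too few unplanted cliques, some such layer has too
  many bottleneck cliques, or a bottleneck clique of size \<open>Q\<close> exists. The number
  \<open>\<epsilon>\<close> bounds the ratio of the expected counts uniformly in these
  layers.\<close>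

lemma prob_layers_bounded:
  fixes n r Q :: nat and P :: "nat set" and \<rho> :: real
  assumes P: "P \<subseteq> {..<n}" and r: "0 < r" "r \<le> Q" "Q < n - card P" and \<rho>: "0 < \<rho>"
  defines "m \<equiv> n - card P"
  defines "\<epsilon> \<equiv> (real (card P) * real Q / real (m - Q)) ^ r * 2 ^ (r choose 2)"
  shows "measure_pmf.prob (random_graph n)
      {E. \<forall>q. real (card {C\<in>cliques n (E \<union> nsets P 2). card (C \<inter> P) = r \<and> card C = q}) \<le>
           \<rho> * real (card {C\<in>cliques n (E \<union> nsets P 2). card (C \<inter> P) < r \<and> card C = q})} \<ge>
    1 - (real (Suc Q) * (4 * (exp (2 powr (real Q / 2) * (real Q)\<^sup>2 / real m) - 1))
         + real (Suc Q) * (2 * \<epsilon> / \<rho>) + \<epsilon> * (real (m choose Q) * (1/2) ^ (Q choose 2)))"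
proof -
  \<comment> \<open>\<open>N\<close> counts the bottleneck cliques. \<open>Z\<close> counts cliques
    avoiding \<open>P\<close>, which all have intersection \<open>0 < r\<close> and so bound the
    other side from below; \<open>\<mu>\<close> is the mean of \<open>Z\<close>.\<close>
  define N where "N = (\<lambda>q E. real (card {C\<in>nsets {..<n} q. card (C \<inter> P) = r \<and> clique C (E \<union> nsets P 2)}))"
  define Z where "Z = (\<lambda>q E. real (card {C\<in>nsets ({..<n} - P) q. nsets C 2 \<subseteq> E}))"
  define \<mu> where "\<mu> = (\<lambda>q. real (m choose q) * (1/2) ^ (q choose 2))"
  define G where "G = {E. \<forall>q. real (card {C\<in>cliques n (E \<union> nsets P 2). card (C \<inter> P) = r \<and> card C = q}) \<le>
           \<rho> * real (card {C\<in>cliques n (E \<union> nsets P 2). card (C \<inter> P) < r \<and> card C = q})}"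
  let ?\<mu> = "random_graph n"
  have finP: "finite P" using P finite_subset by blast
  have \<mu>_pos: "\<mu> q > 0" if "q \<le> Q" for q using that r by (simp add: \<mu>_def m_def)
  have N_eq: "{C\<in>cliques n E. card (C \<inter> P) = r \<and> card C = q} =
        {C\<in>nsets {..<n} q. card (C \<inter> P) = r \<and> clique C E}" for q E
    using finite_subset[of _ "{..<n}"] by (auto simp: cliques_def nsets_def)
  have Z_le: "Z q E \<le> real (card {C\<in>cliques n (E \<union> nsets P 2). card (C \<inter> P) < r \<and> card C = q})" for q E
  proof -
    have "card (C \<inter> P) = 0" if "C \<in> nsets ({..<n} - P) q" for C
    proof -
      have "C \<inter> P = {}" using that by (auto simp: nsets_def)
      then show ?thesis by simp
    qed
    then have "{C\<in>nsets ({..<n} - P) q. nsets C 2 \<subseteq> E} \<subseteq>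
      {C\<in>cliques n (E \<union> nsets P 2). card (C \<inter> P) < r \<and> card C = q}"
      using r(1) by (auto simp: cliques_def clique_iff_nsets_subset) (auto simp: nsets_def)
    then show ?thesis
      unfolding Z_def by (intro of_nat_mono card_mono) (auto intro: finite_subset[OF _ finite_cliques])
  qed
  \<comment> \<open>Deleting unplanted vertices shrinks a larger clique to one of size \<open>Q\<close>.\<close>
  have N_zero: "N q E = 0" if "N Q E < 1" "Q \<le> q" for q E
  proof -
    have fin: "finite {C\<in>nsets {..<n} q. card (C \<inter> P) = r \<and> clique C (E \<union> nsets P 2)}" for q
      by (simp add: finite_imp_finite_nsets)
    have empty: "{C\<in>nsets {..<n} Q. card (C \<inter> P) = r \<and> clique C (E \<union> nsets P 2)} = {}"
      using that(1) fin[of Q] by (simp add: N_def)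
    have False if C: "C \<in> nsets {..<n} q" "card (C \<inter> P) = r" "clique C (E \<union> nsets P 2)" for C
    proof -
      have finC: "finite C" "card C = q" "C \<subseteq> {..<n}" using C(1) by (auto simp: nsets_def)
      have "card (C - P) = q - r" using finC C(2) by (simp add: card_Diff_subset_Int)
      then have "Q - r \<le> card (C - P)" using \<open>Q \<le> q\<close> by simp
      \<comment> \<open>All planted vertices of \<open>C\<close> are kept and \<open>Q - r\<close>
        unplanted ones are added, so the intersection stays \<open>r\<close> and the size becomes
        \<open>Q\<close>.\<close>
      then obtain D where D: "D \<subseteq> C - P" "card D = Q - r"
        using obtain_subset_with_card_n by metis
      have finD: "finite D" using D finC finite_subset by blast
      have "card ((C \<inter> P) \<union> D) = Q"
        using D finC finD C(2) r(2) by (subst card_Un_disjoint) auto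
      moreover have "((C \<inter> P) \<union> D) \<inter> P = C \<inter> P" using D by auto
      moreover have "clique ((C \<inter> P) \<union> D) (E \<union> nsets P 2)"
        by (rule smaller_clique[OF C(3)]) (use D in auto)
      ultimately have "(C \<inter> P) \<union> D \<in> {C\<in>nsets {..<n} Q. card (C \<inter> P) = r \<and> clique C (E \<union> nsets P 2)}"
        using C(2) finC finD D by (auto simp: nsets_def)
      then show False using empty by blast
    qed
    then have "{C\<in>nsets {..<n} q. card (C \<inter> P) = r \<and> clique C (E \<union> nsets P 2)} = {}" by blast
    then show ?thesis by (simp only: N_def card.empty of_nat_0)
  qed
  have N_small: "N q E = 0" if "q < r" for q E
  proof -
    have "card (C \<inter> P) \<noteq> r" if "C \<in> nsets {..<n} q" for C
      using that \<open>q < r\<close> card_mono[of C "C \<inter> P"] by (auto simp: nsets_def)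
    then have "{C\<in>nsets {..<n} q. card (C \<inter> P) = r \<and> clique C (E \<union> nsets P 2)} = {}" by blast
    then show ?thesis by (simp only: N_def card.empty of_nat_0)
  qed
  \<comment> \<open>The thresholds of \<open>B1\<close> and \<open>B2\<close> are matched: outside
    both, \<open>N\<close> is below \<open>\<rho> * \<mu> / 2\<close>, which is below
    \<open>\<rho> * Z\<close>.\<close>
  define B1 where "B1 = (\<lambda>q. {E. Z q E \<le> \<mu> q / 2})"
  define B2 where "B2 = (\<lambda>q. {E. N q E \<ge> \<rho> * \<mu> q / 2})"
  define B3 where "B3 = {E. N Q E \<ge> 1}"
  have sub: "- G \<subseteq> ((\<Union>q\<in>{r..Q}. B1 q) \<union> (\<Union>q\<in>{r..Q}. B2 q)) \<union> B3"
  proof (rule subsetI, rule ccontr)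
    fix E assume E: "E \<in> - G" "E \<notin> ((\<Union>q\<in>{r..Q}. B1 q) \<union> (\<Union>q\<in>{r..Q}. B2 q)) \<union> B3"
    have "N q E \<le> \<rho> * Z q E" for q
    proof (cases "r \<le> q \<and> q \<le> Q")
      case True
      then have "E \<notin> B1 q" "E \<notin> B2 q" using E(2) by auto
      then have "Z q E > \<mu> q / 2" "N q E < \<rho> * (\<mu> q / 2)"
        by (auto simp: B1_def B2_def)
      moreover have "\<rho> * (\<mu> q / 2) \<le> \<rho> * Z q E" if "Z q E > \<mu> q / 2"
        using that \<rho> by (intro mult_left_mono) auto
      ultimately show ?thesis by linarith
    next
      case False
      then have "N q E = 0"
        using N_small N_zero[of E q] E(2) by (auto simp: B3_def)
      then show ?thesis using \<rho> by (simp add: Z_def)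
    qed
    then have "N q E \<le> \<rho> * real (card {C\<in>cliques n (E \<union> nsets P 2). card (C \<inter> P) < r \<and> card C = q})" for q
      using Z_le[of q E] \<rho> by (meson mult_left_mono less_imp_le order_trans)
    then have "E \<in> G" unfolding G_def N_eq N_def by simp
    then show False using E(1) by simp
  qed
  have first: "measure_pmf.prob ?\<mu> {E. N q E \<ge> a} \<le> \<epsilon> * \<mu> q / a" if "q \<in> {r..Q}" "0 < a" for q a
  proof -
    have "measure_pmf.prob ?\<mu> {E. N q E \<ge> a} \<le>
      real (card P choose r) * real (m choose (q - r)) * (1/2) ^ ((q choose 2) - (r choose 2)) / a"
      unfolding N_def m_def by (rule planted_clique_first_moment[OF P that(2)])
    also have "real (card P choose r) * real (m choose (q - r)) * (1/2) ^ ((q choose 2) - (r choose 2)) \<le>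
      (real (card P) * real q / real (m - q)) ^ r * 2 ^ (r choose 2) * \<mu> q"
      unfolding \<mu>_def by (rule binomial_layer_ratio) (use that r in \<open>auto simp: m_def\<close>)
    \<comment> \<open>Passing from \<open>q\<close> to \<open>Q\<close> raises the numerator and
      lowers the denominator \<open>m - q\<close>, so one \<open>\<epsilon>\<close> serves all
      layers.\<close>
    also have "\<dots> \<le> \<epsilon> * \<mu> q"
      unfolding \<epsilon>_def using that r \<mu>_pos[of q]
      by (intro mult_right_mono power_mono frac_le mult_left_mono) (auto simp: m_def)
    finally show ?thesis using that by (simp add: divide_right_mono)
  qed
  have p1: "measure_pmf.prob ?\<mu> (B1 q) \<le> 4 * (exp (2 powr (real Q / 2) * (real Q)\<^sup>2 / real m) - 1)"
    if "q \<in> {r..Q}" for q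
  proof -
    have m: "card ({..<n} - P) = m" using P finP by (simp add: m_def card_Diff_subset)
    have "measure_pmf.prob ?\<mu> (B1 q) \<le> 4 * (exp (2 powr (real q / 2) * (real q)\<^sup>2 / real m) - 1)"
      using prob_clique_count_small[of "{..<n} - P" n q] that r
      unfolding m B1_def Z_def \<mu>_def by (simp add: m_def)
    also have "2 powr (real q / 2) * (real q)\<^sup>2 / real m \<le> 2 powr (real Q / 2) * (real Q)\<^sup>2 / real m"
      using that by (intro divide_right_mono mult_mono power_mono) auto
    finally show ?thesis by simp
  qed
  have p2: "measure_pmf.prob ?\<mu> (B2 q) \<le> 2 * \<epsilon> / \<rho>" if "q \<in> {r..Q}" for q
    using first[OF that, of "\<rho> * \<mu> q / 2"] \<rho> \<mu>_pos[of q] that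
    by (simp add: B2_def mult.commute[of 2 \<epsilon>])
  have p3: "measure_pmf.prob ?\<mu> B3 \<le> \<epsilon> * \<mu> Q"
    using first[of Q 1] r by (simp add: B3_def)
  have union: "measure_pmf.prob ?\<mu> (\<Union>q\<in>{r..Q}. B q) \<le> real (Suc Q) * b"
    if "\<And>q. q \<in> {r..Q} \<Longrightarrow> measure_pmf.prob ?\<mu> (B q) \<le> b" "0 \<le> b" for B b
  proof -
    have "measure_pmf.prob ?\<mu> (\<Union>q\<in>{r..Q}. B q) \<le> (\<Sum>q\<in>{r..Q}. measure_pmf.prob ?\<mu> (B q))"
      by (rule measure_pmf.finite_measure_subadditive_finite) auto
    also have "\<dots> \<le> (\<Sum>q\<in>{r..Q}. b)" by (intro sum_mono that)
    also have "\<dots> \<le> real (Suc Q) * b"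
      using that(2) r by (simp add: mult_right_mono)
    finally show ?thesis .
  qed
  have \<epsilon>0: "0 \<le> \<epsilon>" by (simp add: \<epsilon>_def)
  have "measure_pmf.prob ?\<mu> (- G) \<le>
      measure_pmf.prob ?\<mu> (((\<Union>q\<in>{r..Q}. B1 q) \<union> (\<Union>q\<in>{r..Q}. B2 q)) \<union> B3)"
    by (rule measure_pmf.finite_measure_mono[OF sub]) auto
  also have "\<dots> \<le> measure_pmf.prob ?\<mu> (\<Union>q\<in>{r..Q}. B1 q) + measure_pmf.prob ?\<mu> (\<Union>q\<in>{r..Q}. B2 q)
      + measure_pmf.prob ?\<mu> B3"
    by (intro order_trans[OF measure_Un_le] add_mono order_refl) auto
  also have "\<dots> \<le> real (Suc Q) * (4 * (exp (2 powr (real Q / 2) * (real Q)\<^sup>2 / real m) - 1))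
         + real (Suc Q) * (2 * \<epsilon> / \<rho>) + \<epsilon> * \<mu> Q"
    by (intro add_mono union p1 p2 p3) (use \<epsilon>0 \<rho> in auto)
  finally show ?thesis
    using measure_pmf.prob_compl[of G ?\<mu>] unfolding G_def[symmetric] \<mu>_def
    by (simp add: Compl_eq_Diff_UNIV)
qed

text \<open>The planted set is independent of the random graph, so it can be drawn first; a bound
  that holds for every fixed \<open>P\<close> survives averaging over \<open>P\<close>.\<close>

lemma prob_planted_clique_model_ge:
  assumes "k \<le> n"
    and "\<And>P. P \<in> nsets {..<n} k \<Longrightarrow>
           measure_pmf.prob (random_graph n) {E. Q (E \<union> nsets P 2) P} \<ge> b"
  shows "measure_pmf.prob (planted_clique_model n k) {(E, P). card P = k \<and> Q E P} \<ge> b"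
proof -
  have ne: "nsets {..<n} k \<noteq> {}"
    using assms(1) by (auto simp: nsets_eq_empty_iff)
  have fin: "finite (nsets {..<n} k)" by (simp add: finite_imp_finite_nsets)
  have "planted_clique_model n k = pmf_of_set (nsets {..<n} k) \<bind>
      (\<lambda>P. map_pmf (\<lambda>E. (E \<union> nsets P 2, P)) (random_graph n))"
    unfolding planted_clique_model_def map_pmf_def by (rule bind_commute_pmf)
  then have "measure_pmf.prob (planted_clique_model n k) {(E, P). card P = k \<and> Q E P} =
    (\<Sum>P\<in>nsets {..<n} k. measure_pmf.prob (random_graph n) {E. card P = k \<and> Q (E \<union> nsets P 2) P})
      / real (card (nsets {..<n} k))"
    by (simp add: measure_bind_pmf integral_pmf_of_set[OF ne fin] vimage_def)
  also have "\<dots> = (\<Sum>P\<in>nsets {..<n} k. measure_pmf.prob (random_graph n) {E. Q (E \<union> nsets P 2) P})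
      / real (card (nsets {..<n} k))"
    by (intro arg_cong2[where f = "(/)"] sum.cong refl) (auto simp: nsets_def)
  also have "\<dots> \<ge> (\<Sum>P\<in>nsets {..<n} k. b) / real (card (nsets {..<n} k))"
    by (intro divide_right_mono sum_mono assms(2)) auto
  finally show ?thesis using ne fin by (simp del: card_nsets)
qed

subsection \<open>Asymptotics\<close>

text \<open>All numerical work at a single \<open>n\<close>, from conditions that hold eventually.
  The three final bounds feed the error terms of \<open>prob_layers_bounded\<close>.\<close>

lemma parameter_estimates:
  fixes \<alpha> y :: real and n :: nat
  defines "L \<equiv> log 2 (real n)"
  defines "c \<equiv> (1 - \<alpha>) * y / 16"
  defines "k \<equiv> nat \<lfloor>real n powr \<alpha>\<rfloor>" and "r \<equiv> nat \<lfloor>y * L\<rfloor>" and "Q \<equiv> nat \<lfloor>(2 - c) * L\<rfloor>"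
  defines "\<epsilon> \<equiv> (real k * real Q / real (n - k - Q)) ^ r * 2 ^ (r choose 2)"
  assumes \<alpha>: "0 < \<alpha>" "\<alpha> < 1" and y: "0 < y" "y \<le> 1 - \<alpha>"
    and n: "2 \<le> n" "real n powr \<alpha> \<le> real n / 8" "2 * L \<le> real n / 8" "2 \<le> y * L"
      "4 * L * real n powr (- (1 - \<alpha>) / 2) \<le> real n powr (- (1 - \<alpha>) / 4)"
  shows "k \<le> n" "0 < r" "r \<le> Q" "Q < n - k" "real Q \<le> 2 * L"
    and "\<epsilon> \<le> 2 powr (- 2 * c * L\<^sup>2)"
    and "2 powr (real Q / 2) * (real Q)\<^sup>2 / real (n - k) \<le> 8 * L\<^sup>2 * real n powr (- c / 2)"
    and "real ((n - k) choose Q) * (1/2) ^ (Q choose 2) \<le> 2 powr (c * L\<^sup>2 + 2 * L)"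
proof -
  have L1: "1 \<le> L" using n(1) by (simp add: L_def)
  have c: "0 < c" "c < 1"
  proof -
    show "0 < c" using \<alpha> y by (simp add: c_def)
    have "(1 - \<alpha>) * y \<le> 1 * 1" using \<alpha> y by (intro mult_mono) auto
    then show "c < 1" by (simp add: c_def)
  qed
  have n_powr: "real n powr s = 2 powr (L * s)" for s
    using n(1) by (simp add: L_def powr_powr[symmetric])
  have n_eq: "real n = 2 powr L" using n(1) by (simp add: L_def)
  have k: "real k \<le> real n powr \<alpha>" by (simp add: k_def)
  have k8: "real k \<le> real n / 8" using k n(2) by linarith
  then show kn: "k \<le> n" by linarith
  have Q: "real Q \<le> (2 - c) * L" "real Q \<ge> (2 - c) * L - 1"
    using c L1 by (auto simp: Q_def)
  have "(2 - c) * L \<le> 2 * L" using c L1 by (intro mult_right_mono) auto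
  with Q show Q2: "real Q \<le> 2 * L" by linarith
  have Q8: "real Q \<le> real n / 8" using Q2 n(3) by linarith
  have m: "real (n - k) \<ge> real n / 2" using k8 kn by (simp add: of_nat_diff)
  show Qm: "Q < n - k" using m Q8 n(1) by linarith
  have mQ: "real (n - k - Q) \<ge> real n / 2" using k8 Q8 Qm kn by (simp add: of_nat_diff)
  have r: "real r \<le> y * L" using y L1 by (simp add: r_def)
  \<comment> \<open>Rounding down loses less than one, which is at most half of \<open>y * L\<close>
    because \<open>2 \<le> y * L\<close>.\<close>
  have r2: "real r \<ge> y * L / 2" using n(4) by (simp add: r_def) linarith
  then show "0 < r" using n(4) by linarith
  have "y * L \<le> (2 - c) * L" using y c \<alpha> L1 by (intro mult_right_mono) auto
  then show rQ: "r \<le> Q" unfolding r_def Q_def by (intro nat_mono floor_mono)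

  show "\<epsilon> \<le> 2 powr (- 2 * c * L\<^sup>2)"
  proof -
    have "real k * real Q / real (n - k - Q) \<le> (real n powr \<alpha> * (2 * L)) / (real n / 2)"
      using k Q2 mQ n(1) L1 by (intro frac_le mult_mono) auto
    also have "\<dots> = 4 * L * 2 powr (- (1 - \<alpha>) * L)"
      unfolding n_powr by (simp add: n_eq field_simps powr_diff)
    finally have base: "real k * real Q / real (n - k - Q) \<le> 4 * L * 2 powr (- (1 - \<alpha>) * L)" .
    \<comment> \<open>Here \<open>y \<le> 1 - \<alpha>\<close> enters: the planted pairs cancel at
      most half of the exponent gained from the \<open>r\<close> factors of order
      \<open>n powr (\<alpha> - 1)\<close>.\<close>
    have "real (r choose 2) \<le> (1 - \<alpha>) * L / 2 * real r"
    proof -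
      have "real r - 1 \<le> (1 - \<alpha>) * L"
        using r mult_right_mono[OF y(2), of L] L1 by linarith
      then have "real r * (real r - 1) \<le> real r * ((1 - \<alpha>) * L)"
        by (intro mult_left_mono) auto
      moreover have "(1 - \<alpha>) * L / 2 * real r = real r * ((1 - \<alpha>) * L) / 2" by simp
      ultimately show ?thesis unfolding choose_two_real by linarith
    qed
    then have "2 powr real (r choose 2) \<le> 2 powr ((1 - \<alpha>) * L / 2 * real r)"
      by simp
    then have two: "2 ^ (r choose 2) \<le> (2 powr ((1 - \<alpha>) * L / 2)) ^ r"
      by (simp add: powr_power powr_realpow mult_ac)
    have "\<epsilon> \<le> (4 * L * 2 powr (- (1 - \<alpha>) * L)) ^ r * (2 powr ((1 - \<alpha>) * L / 2)) ^ r"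
      unfolding \<epsilon>_def by (intro mult_mono power_mono base two) (use L1 in auto)
    also have "\<dots> = (4 * L * (2 powr (- (1 - \<alpha>) * L) * 2 powr ((1 - \<alpha>) * L / 2))) ^ r"
      by (simp add: power_mult_distrib mult_ac)
    also have "2 powr (- (1 - \<alpha>) * L) * 2 powr ((1 - \<alpha>) * L / 2) = real n powr (- (1 - \<alpha>) / 2)"
      unfolding n_powr powr_add[symmetric] by (rule arg_cong[where f = "(powr) 2"]) (simp add: field_simps)
    \<comment> \<open>The factor \<open>4 * L\<close> is absorbed by half of the remaining exponent.
      With \<open>r\<close> at least \<open>y * L / 2\<close> this leaves
      \<open>(1 - \<alpha>) * y / 8 = 2 * c\<close> as the coefficient of the squared
      logarithm.\<close>
    also have "(4 * L * real n powr (- (1 - \<alpha>) / 2)) ^ r \<le> (real n powr (- (1 - \<alpha>) / 4)) ^ r"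
      by (intro power_mono n(5)) (use L1 in auto)
    also have "\<dots> = (2 powr (- ((1 - \<alpha>) / 4 * L))) ^ r"
      unfolding n_powr by (rule arg_cong[where f = "\<lambda>s. (2 powr s) ^ r"])
        (simp only: minus_divide_left[symmetric] mult_minus_right mult.commute)
    also have "\<dots> = 2 powr (- ((1 - \<alpha>) / 4 * L) * real r)"
      by (subst powr_power) (auto simp only: mult.commute)
    also have "\<dots> \<le> 2 powr (- ((1 - \<alpha>) / 4 * L) * (y * L / 2))"
      using r2 \<alpha> L1 by (intro powr_mono mult_left_mono_neg) auto
    also have "- ((1 - \<alpha>) / 4 * L) * (y * L / 2) = - 2 * c * L\<^sup>2"
      by (simp add: c_def power2_eq_square)
    finally show ?thesis .
  qed
  \<comment> \<open>As \<open>Q\<close> stays below \<open>2 * L\<close> by the margin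
    \<open>c * L\<close>, the power \<open>2 powr (Q / 2)\<close> is smaller than \<open>n\<close>
    by a factor \<open>n powr (- c / 2)\<close>.\<close>
  show "2 powr (real Q / 2) * (real Q)\<^sup>2 / real (n - k) \<le> 8 * L\<^sup>2 * real n powr (- c / 2)"
  proof -
    have "2 powr (real Q / 2) * (real Q)\<^sup>2 / real (n - k) \<le>
      2 powr ((2 - c) * L / 2) * (2 * L)\<^sup>2 / (real n / 2)"
      using Q(1) Q2 m n(1) by (intro frac_le mult_mono power_mono powr_mono) auto
    also have "\<dots> = 8 * L\<^sup>2 * (2 powr ((2 - c) * L / 2) / 2 powr L)"
      by (simp add: n_eq power_mult_distrib)
    also have "2 powr ((2 - c) * L / 2) / 2 powr L = real n powr (- c / 2)"
      unfolding n_powr powr_diff[symmetric] by (rule arg_cong[where f = "(powr) 2"]) (simp add: field_simps)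
    finally show ?thesis .
  qed
  \<comment> \<open>\<open>Q\<close> is so close to \<open>2 * L\<close> that the mean has exponent
    only about \<open>c * L * L\<close>, which the bound on \<open>\<epsilon>\<close>
    outweighs.\<close>
  show "real ((n - k) choose Q) * (1/2) ^ (Q choose 2) \<le> 2 powr (c * L\<^sup>2 + 2 * L)"
  proof -
    have "real ((n - k) choose Q) \<le> real (n - k) ^ Q"
      using binomial_le_pow[of Q "n - k"] Qm by (metis less_imp_le of_nat_le_iff of_nat_power)
    also have "\<dots> \<le> real n ^ Q" by (intro power_mono) auto
    also have "\<dots> = 2 powr (L * real Q)"
      by (simp add: n_eq powr_realpow[symmetric] powr_powr)
    finally have choose_le: "real ((n - k) choose Q) \<le> 2 powr (L * real Q)" .
    have "(1/2::real) ^ (Q choose 2) = 2 powr (- real (Q choose 2))"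
      by (simp add: powr_minus_divide powr_realpow power_one_over)
    with choose_le have "real ((n - k) choose Q) * (1/2) ^ (Q choose 2) \<le>
        2 powr (L * real Q) * 2 powr (- real (Q choose 2))"
      by (simp add: mult_right_mono)
    also have "2 powr (L * real Q) * 2 powr (- real (Q choose 2)) =
        2 powr (real Q * (L - (real Q - 1) / 2))"
      unfolding powr_add[symmetric] by (simp add: choose_two_real algebra_simps)
    also have "\<dots> \<le> 2 powr (2 * L * (c * L / 2 + 1))"
    proof (rule powr_mono)
      have "L - (real Q - 1) / 2 \<le> c * L / 2 + 1" using Q(2) by (simp add: field_simps)
      then have "real Q * (L - (real Q - 1) / 2) \<le> real Q * (c * L / 2 + 1)"
        by (intro mult_left_mono) auto
      also have "\<dots> \<le> 2 * L * (c * L / 2 + 1)"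
        using Q2 c L1 by (intro mult_right_mono) auto
      finally show "real Q * (L - (real Q - 1) / 2) \<le> 2 * L * (c * L / 2 + 1)" .
    qed simp
    also have "2 * L * (c * L / 2 + 1) = c * L\<^sup>2 + 2 * L"
      by (simp add: power2_eq_square algebra_simps)
    finally show ?thesis .
  qed
qed

text \<open>The ratio \<open>\<rho>\<close> is the square root of the bound on
  \<open>\<epsilon>\<close>: then \<open>\<epsilon> / \<rho>\<close> is at most
  \<open>\<rho>\<close>, so Markov's inequality still has a vanishing error while
  \<open>\<rho>\<close> stays quasi-polynomially small.\<close>

lemma planted_clique_layers_whp:
  fixes \<alpha> y :: real
  assumes \<alpha>: "0 < \<alpha>" "\<alpha> < 1" and y: "0 < y" "y \<le> 1 - \<alpha>"
  defines "c \<equiv> (1 - \<alpha>) * y / 16"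
  defines "k \<equiv> \<lambda>n. nat \<lfloor>real n powr \<alpha>\<rfloor>" and "r \<equiv> \<lambda>n. nat \<lfloor>y * log 2 (real n)\<rfloor>"
  shows "(\<lambda>n. measure_pmf.prob (planted_clique_model n (k n))
     {(E, P). card P = k n \<and>
       (\<forall>q. real (card {C\<in>cliques n E. card (C \<inter> P) = r n \<and> card C = q}) \<le>
             2 powr (- c * (log 2 (real n))\<^sup>2) *
             real (card {C\<in>cliques n E. card (C \<inter> P) < r n \<and> card C = q}))}) \<longlonglongrightarrow> 1"
    (is "?prob \<longlonglongrightarrow> 1")
proof (rule tendsto_sandwich)
  let ?L = "\<lambda>n. log 2 (real n)"
  have c: "0 < c" using \<alpha> y by (simp add: c_def)
  let ?err = "\<lambda>n. (2 * ?L n + 1) * (4 * (exp (8 * (?L n)\<^sup>2 * real n powr (- c / 2)) - 1)) +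
      (2 * ?L n + 1) * (2 * 2 powr (- c * (?L n)\<^sup>2)) + 2 powr (- c * (?L n)\<^sup>2 + 2 * ?L n)"
  have "(\<lambda>n. (2 * ?L n + 1) * (4 * (exp (8 * (?L n)\<^sup>2 * real n powr (- c / 2)) - 1))) \<longlonglongrightarrow> 0"
    "(\<lambda>n. (2 * ?L n + 1) * (2 * 2 powr (- c * (?L n)\<^sup>2))) \<longlonglongrightarrow> 0"
    "(\<lambda>n. 2 powr (- c * (?L n)\<^sup>2 + 2 * ?L n)) \<longlonglongrightarrow> 0"
    using c by real_asymp+
  then have "?err \<longlonglongrightarrow> 0 + 0 + 0" by (intro tendsto_add)
  then show "(\<lambda>n. 1 - ?err n) \<longlonglongrightarrow> 1"
    using tendsto_diff[OF tendsto_const, of ?err 0 sequentially 1] by simp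
  show "\<forall>\<^sub>F n in sequentially. ?prob n \<le> 1" by simp
  have "\<forall>\<^sub>F n in sequentially. real n powr \<alpha> \<le> real n / 8"
    "\<forall>\<^sub>F n in sequentially. 2 * ?L n \<le> real n / 8"
    "\<forall>\<^sub>F n in sequentially. 2 \<le> y * ?L n"
    "\<forall>\<^sub>F n in sequentially. 4 * ?L n * real n powr (- (1 - \<alpha>) / 2) \<le> real n powr (- (1 - \<alpha>) / 4)"
    using \<alpha> y(1) by real_asymp+
  with eventually_ge_at_top[of 2] show "\<forall>\<^sub>F n in sequentially. 1 - ?err n \<le> ?prob n"
  proof eventually_elim
    case (elim n)
    define Q where "Q = nat \<lfloor>(2 - c) * ?L n\<rfloor>"
    define \<epsilon> where "\<epsilon> = (real (k n) * real Q / real (n - k n - Q)) ^ r n * 2 ^ (r n choose 2)"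
    define \<rho> where "\<rho> = 2 powr (- c * (?L n)\<^sup>2)"
    have "k n = nat \<lfloor>real n powr \<alpha>\<rfloor>" "r n = nat \<lfloor>y * ?L n\<rfloor>"
      by (simp_all add: k_def r_def)
    note est = parameter_estimates[OF \<alpha> y elim(1,2,3,4,5),
        folded c_def, folded this Q_def, folded \<epsilon>_def]
    have \<rho>: "0 < \<rho>" by (simp add: \<rho>_def)
    show ?case
    proof (rule prob_planted_clique_model_ge[OF est(1), where Q = "\<lambda>E P. \<forall>q.
        real (card {C\<in>cliques n E. card (C \<inter> P) = r n \<and> card C = q}) \<le> 2 powr (- c * (?L n)\<^sup>2) *
          real (card {C\<in>cliques n E. card (C \<inter> P) < r n \<and> card C = q})"])
      fix P assume "P \<in> nsets {..<n} (k n)"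
      then have P: "P \<subseteq> {..<n}" "card P = k n" by (auto simp: nsets_def)
      have Q: "real (Suc Q) \<le> 2 * ?L n + 1" using est(5) by simp
      have "real (Suc Q) * (4 * (exp (2 powr (real Q / 2) * (real Q)\<^sup>2 / real (n - k n)) - 1)) \<le>
        (2 * ?L n + 1) * (4 * (exp (8 * (?L n)\<^sup>2 * real n powr (- c / 2)) - 1))"
        using Q est(7) by (intro mult_mono) auto
      moreover have "real (Suc Q) * (2 * \<epsilon> / \<rho>) \<le> (2 * ?L n + 1) * (2 * \<rho>)"
      proof (rule mult_mono[OF Q])
        have "\<epsilon> / \<rho> \<le> 2 powr (- 2 * c * (?L n)\<^sup>2) / \<rho>"
          using est(6) \<rho> by (intro divide_right_mono) auto
        also have "\<dots> = \<rho>" by (simp add: \<rho>_def powr_diff[symmetric])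
        finally show "2 * \<epsilon> / \<rho> \<le> 2 * \<rho>" by simp
      qed (use Q \<rho> in \<open>auto simp: \<epsilon>_def\<close>)
      \<comment> \<open>The exponents \<open>- 2 * c\<close> and \<open>c\<close> combine to
        \<open>- c\<close>, so bottleneck cliques of size \<open>Q\<close> are unlikely to
        exist.\<close>
      moreover have "\<epsilon> * (real ((n - k n) choose Q) * (1/2) ^ (Q choose 2)) \<le>
          2 powr (- 2 * c * (?L n)\<^sup>2) * 2 powr (c * (?L n)\<^sup>2 + 2 * ?L n)"
        by (intro mult_mono est) auto
      moreover have "\<dots> = 2 powr (- c * (?L n)\<^sup>2 + 2 * ?L n)"
        by (simp add: powr_add[symmetric])
      moreover note prob_layers_bounded[OF P(1) est(2,3), unfolded P(2), OF est(4) \<rho>, folded \<epsilon>_def]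
      ultimately show "1 - ?err n \<le> measure_pmf.prob (random_graph n)
         {E. \<forall>q. real (card {C\<in>cliques n (E \<union> nsets P 2). card (C \<inter> P) = r n \<and> card C = q}) \<le>
             2 powr (- c * (?L n)\<^sup>2) *
             real (card {C\<in>cliques n (E \<union> nsets P 2). card (C \<inter> P) < r n \<and> card C = q})}"
        unfolding \<rho>_def by linarith
    qed
  qed
qed simp

theorem theorem6p1:
  fixes \<alpha> \<gamma> :: real
  assumes "0 < \<alpha>" "\<alpha> < 1" "0 < \<gamma>"
  shows "\<exists>c>0.
    ((\<lambda>n. measure_pmf.prob (planted_clique_model n (nat \<lfloor>real n powr \<alpha>\<rfloor>))
        {(E, PC). \<forall>(h :: nat \<Rightarrow> real) (\<beta> :: real). \<exists>x0\<in>cliques n E.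
           measure_pmf.prob (metropolis_path n E h \<beta> (nat \<lceil>real n powr (c * log 2 (real n))\<rceil>) x0)
             {X. \<exists>t < length X. real t < real n powr (c * log 2 (real n)) \<and>
                   real (card (X ! t \<inter> PC)) \<ge> \<gamma> * log 2 (real n)}
           \<le> real n powr (- (c * log 2 (real n)))}) \<longlonglongrightarrow> 1) \<and>
    (\<forall>d :: nat.
      (\<lambda>n. measure_pmf.prob (planted_clique_model n (nat \<lfloor>real n powr \<alpha>\<rfloor>))
        {(E, PC). \<forall>(h :: nat \<Rightarrow> real) (\<beta> :: real). \<exists>x0\<in>cliques n E.
           measure_pmf.prob (metropolis_path n E h \<beta> (n ^ d) x0) {X. \<exists>t \<le> n ^ d. X ! t = PC}
           \<le> real n powr (- (c * log 2 (real n)))}) \<longlonglongrightarrow> 1)"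
proof -
  \<comment> \<open>\<open>y \<le> \<gamma>\<close> places the bottleneck at or below the target
    intersection; \<open>y \<le> 1 - \<alpha>\<close> keeps the bottleneck layers small.\<close>
  define y where "y = min \<gamma> (1 - \<alpha>)"
  have y: "0 < y" "y \<le> 1 - \<alpha>" "y \<le> \<gamma>" using assms by (auto simp: y_def)
  \<comment> \<open>A third of the exponent available in \<open>\<rho>\<close>: one share pays for
    the time horizon, one is the claimed failure probability, and one absorbs rounding.\<close>
  define c where "c = (1 - \<alpha>) * y / 48"
  have c: "0 < c" using assms y by (simp add: c_def)
  let ?L = "\<lambda>n. log 2 (real n)"
  define k where "k = (\<lambda>n. nat \<lfloor>real n powr \<alpha>\<rfloor>)"
  define r where "r = (\<lambda>n. nat \<lfloor>y * ?L n\<rfloor>)"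
  define \<rho> where "\<rho> = (\<lambda>n. 2 powr (- (3 * c) * (?L n)\<^sup>2))"
  define Good where "Good = (\<lambda>n. {(E, P). card P = k n \<and>
       (\<forall>q. real (card {C\<in>cliques n E. card (C \<inter> P) = r n \<and> card C = q}) \<le>
             \<rho> n * real (card {C\<in>cliques n E. card (C \<inter> P) < r n \<and> card C = q}))})"
  have Good: "(\<lambda>n. measure_pmf.prob (planted_clique_model n (k n)) (Good n)) \<longlonglongrightarrow> 1"
  proof -
    have c3: "(1 - \<alpha>) * y / 16 = 3 * c" by (simp add: c_def)
    show ?thesis
      using planted_clique_layers_whp[OF assms(1,2) y(1,2)]
      unfolding c3 Good_def \<rho>_def k_def r_def .
  qed
  have lift: "(\<lambda>n. measure_pmf.prob (planted_clique_model n (k n)) (A n)) \<longlonglongrightarrow> 1"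
    if "\<forall>\<^sub>F n in sequentially. Good n \<subseteq> A n" for A
  proof (rule tendsto_sandwich[OF _ _ Good tendsto_const])
    show "\<forall>\<^sub>F n in sequentially. measure_pmf.prob (planted_clique_model n (k n)) (Good n) \<le>
        measure_pmf.prob (planted_clique_model n (k n)) (A n)"
      using that by eventually_elim (auto intro: measure_pmf.finite_measure_mono)
  qed simp
  \<comment> \<open>The hypothesis on \<open>S\<close> speaks only of lists of length
    \<open>Suc T\<close>, since trajectories almost surely have it; this keeps the indices in
    \<open>X ! t\<close> within range.\<close>
  have slow: "\<exists>x0\<in>cliques n E. measure_pmf.prob (metropolis_path n E h \<beta> T x0) S
      \<le> real n powr (- (c * ?L n))"
    if good: "(E, P) \<in> Good n" "0 < n" "0 < r n" and T: "real T * \<rho> n \<le> real n powr (- (c * ?L n))"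
      and S: "\<And>Xs. Xs \<in> S \<Longrightarrow> length Xs = Suc T \<Longrightarrow> \<exists>C\<in>set Xs. r n \<le> card (C \<inter> P)"
    for n E P h \<beta> T S
  proof -
    obtain x0 where x0: "x0 \<in> cliques n E"
      "measure_pmf.prob (metropolis_path n E h \<beta> T x0) {Xs. \<exists>C\<in>set Xs. r n \<le> card (C \<inter> P)} \<le> T * \<rho> n"
      using metropolis_clique_bottleneck[of n "r n" E P "\<rho> n" h \<beta> T] good by (auto simp: Good_def)
    have "measure_pmf.prob (metropolis_path n E h \<beta> T x0) S \<le>
       measure_pmf.prob (metropolis_path n E h \<beta> T x0) {Xs. \<exists>C\<in>set Xs. r n \<le> card (C \<inter> P)}"
      using S length_metropolis_path
      by (intro measure_pmf.finite_measure_mono_AE) (auto simp: AE_measure_pmf_iff)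
    with x0 T show ?thesis by (meson order_trans)
  qed
  have r_le: "real (r n) \<le> y * ?L n" if "2 \<le> n" for n
    using that y by (simp add: r_def)
  have n_powr: "real n powr (s * ?L n) = 2 powr (s * (?L n)\<^sup>2)" if "2 \<le> n" for n s
  proof -
    have "real n powr (s * ?L n) = (2 powr ?L n) powr (s * ?L n)" using that by simp
    then show ?thesis by (simp only: powr_powr power2_eq_square mult_ac)
  qed
  have n_powr_neg: "real n powr (- (c * ?L n)) = 2 powr (- c * (?L n)\<^sup>2)" if "2 \<le> n" for n
    using n_powr[OF that, of "- c"] by simp
  have r_pos: "\<forall>\<^sub>F n in sequentially. 1 \<le> y * ?L n" using y(1) by real_asymp
  have k_eq: "nat \<lfloor>real n powr \<alpha>\<rfloor> = k n" for n by (simp add: k_def)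
  show ?thesis
    unfolding k_eq
  proof (intro exI[of _ c] conjI allI c lift)
    have "\<forall>\<^sub>F n in sequentially. (2 powr (c * (?L n)\<^sup>2) + 1) * 2 powr (- (3 * c) * (?L n)\<^sup>2) \<le> 2 powr (- c * (?L n)\<^sup>2)"
      using c by real_asymp
    with eventually_ge_at_top[of 2] r_pos
    show "\<forall>\<^sub>F n in sequentially. Good n \<subseteq>
        {(E, PC). \<forall>(h :: nat \<Rightarrow> real) (\<beta> :: real). \<exists>x0\<in>cliques n E.
           measure_pmf.prob (metropolis_path n E h \<beta> (nat \<lceil>real n powr (c * ?L n)\<rceil>) x0)
             {X. \<exists>t < length X. real t < real n powr (c * ?L n) \<and>
                   real (card (X ! t \<inter> PC)) \<ge> \<gamma> * ?L n}
           \<le> real n powr (- (c * ?L n))}"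
    proof eventually_elim
      case (elim n)
      let ?T = "nat \<lceil>real n powr (c * ?L n)\<rceil>"
      have "0 \<le> \<lceil>real n powr (c * ?L n)\<rceil>"
        by (metis ceiling_mono ceiling_zero powr_ge_zero)
      then have "real ?T = of_int \<lceil>real n powr (c * ?L n)\<rceil>" by simp
      then have "real ?T \<le> 2 powr (c * (?L n)\<^sup>2) + 1"
        using n_powr[OF elim(1), of c] of_int_ceiling_le_add_one[of "real n powr (c * ?L n)"] by simp
      then have "real ?T * \<rho> n \<le> (2 powr (c * (?L n)\<^sup>2) + 1) * \<rho> n"
        by (intro mult_right_mono) (auto simp: \<rho>_def)
      then have T: "real ?T * \<rho> n \<le> real n powr (- (c * ?L n))"
        using elim(3) n_powr_neg[OF elim(1)] unfolding \<rho>_def by linarith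
      \<comment> \<open>\<open>r n\<close> is at most \<open>y * ?L n\<close>, hence at most
        \<open>\<gamma> * ?L n\<close>, so a trajectory meeting the target has crossed the
        bottleneck.\<close>
      have j: "r n \<le> j" if "real j \<ge> \<gamma> * ?L n" for j
      proof -
        have "y * ?L n \<le> \<gamma> * ?L n" using y elim(1) by (intro mult_right_mono) auto
        then show ?thesis using r_le[OF elim(1)] that by linarith
      qed
      have "\<exists>C\<in>set X. r n \<le> card (C \<inter> P)"
        if "t < length X" "real (card (X ! t \<inter> P)) \<ge> \<gamma> * ?L n" for X t and P :: "nat set"
        using that j nth_mem by blast
      moreover have "0 < n" "0 < r n" using elim(1,2) by (auto simp: r_def)
      ultimately show ?case
        by (auto intro!: slow T)
    qed
  next
    fix d :: nat
    have "\<forall>\<^sub>F n in sequentially. 2 powr (real d * ?L n) * 2 powr (- (3 * c) * (?L n)\<^sup>2) \<le> 2 powr (- c * (?L n)\<^sup>2)"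
    proof -
      have "\<forall>\<^sub>F n in sequentially. real d * ?L n \<le> 2 * c * (?L n)\<^sup>2"
        using c by real_asymp
      then show ?thesis
        by eventually_elim (simp add: powr_add[symmetric])
    qed
    \<comment> \<open>This yields \<open>r n \<le> k n\<close>: the planted clique meets itself in
      \<open>k n\<close> vertices, so reaching it also requires crossing the bottleneck.\<close>
    moreover have "\<forall>\<^sub>F n in sequentially. y * ?L n + 1 \<le> real n powr \<alpha>"
      using assms y(1) by real_asymp
    ultimately show "\<forall>\<^sub>F n in sequentially. Good n \<subseteq>
        {(E, PC). \<forall>(h :: nat \<Rightarrow> real) (\<beta> :: real). \<exists>x0\<in>cliques n E.
           measure_pmf.prob (metropolis_path n E h \<beta> (n ^ d) x0) {X. \<exists>t \<le> n ^ d. X ! t = PC}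
           \<le> real n powr (- (c * ?L n))}"
      using eventually_ge_at_top[of 2] r_pos
    proof eventually_elim
      case (elim n)
      have "real (n ^ d) = (2 powr ?L n) ^ d" using elim(3) by simp
      also have "\<dots> = 2 powr (real d * ?L n)"
        by (simp only: powr_realpow[symmetric] powr_gt_zero powr_powr mult.commute)
      finally have T: "real (n ^ d) * \<rho> n \<le> real n powr (- (c * ?L n))"
        using elim(1) n_powr_neg[OF elim(3)] unfolding \<rho>_def by simp
      have "r n \<le> k n"
        unfolding r_def k_def using elim(2) by (intro nat_mono floor_mono) linarith
      then have "r n \<le> card (P \<inter> P)" if "(E, P) \<in> Good n" for E P
        using that by (auto simp: Good_def)
      moreover have "P \<in> set Xs" if "t \<le> n ^ d" "Xs ! t = P" "length Xs = Suc (n ^ d)" for t Xs and P :: "nat set"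
        using that nth_mem[of t Xs] by auto
      ultimately have "\<exists>C\<in>set Xs. r n \<le> card (C \<inter> P)"
        if "(E, P) \<in> Good n" "t \<le> n ^ d" "Xs ! t = P" "length Xs = Suc (n ^ d)" for E P t Xs
        using that by blast
      moreover have "0 < n" "0 < r n" using elim(3,4) by (auto simp: r_def)
      ultimately show ?case
        by (auto intro!: slow T simp del: of_nat_power)
    qed
  qed
qed

end
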